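(* Let $\mathcal W_{\Psi^-}=\frac14\mathbb 1\otimes\mathbb 1+\frac14\sum_{k=x,y,z}\sigma_k\otimes\sigma_k$. Let $\chi=\frac12\,\mathrm{arcsec}\sqrt3$ and let $|\psi\rangle$ be the two-qubit product state $$|\psi\rangle=\cos^2\chi\left(|0\rangle+e^{i\pi/4}\tan\chi\,|1\rangle\right)\otimes\left(\tan\chi\,|0\rangle+e^{-3i\pi/4}|1\rangle\right).$$ For $\varepsilon$ real let $\hat n_1=(\cos\varepsilon,\tfrac{\sin\varepsilon}{\sqrt2},\tfrac{\sin\varepsilon}{\sqrt2})$, $\hat n_2=(\tfrac{\sin\varepsilon}{\sqrt2},\cos\varepsilon,\tfrac{\sin\varepsilon}{\sqrt2})$, $\hat n_3=(\tfrac{\sin\varepsilon}{\sqrt2},\tfrac{\sin\varepsilon}{\sqrt2},\cos\varepsilon)$ be misaligned measurement directions (used by both parties) replacing the intended directions $x,y,z$, and let $$\mathcal W_{\Psi^-}^{\varepsilon}=\frac14\mathbb 1\otimes\mathbb 1+\frac14\sum_{k=1}^3(\hat n_k\cdot\vec\sigma)\otimes(\hat n_k\cdot\vec\sigma).$$ Then $$\langle\psi|\mathcal W^{\varepsilon}_{\Psi^-}|\psi\rangle=\frac18\left(\cos2\varepsilon-2\sqrt2\,\sin2\varepsilon-1\right),$$ which is negative for all $0<\varepsilon<\frac\pi2$. Thus, as soon as $\varepsilon>0$, the misaligned evaluation of the entanglement witness $\mathcal W_{\Psi^-}$ on the separable state $|\psi\rangle$ gives a negative value, i.e. an erroneous certification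 of entanglement.
   Context: $\vec\sigma=(\sigma_x,\sigma_y,\sigma_z)$ is the vector of Pauli matrices, and $|0\rangle,|1\rangle$ are the eigenvectors of $\sigma_z$ with eigenvalues $+1,-1$. An entanglement witness is a Hermitian observable $\mathcal W$ with $\mathrm{tr}(\mathcal W\rho)\ge0$ for all separable states $\rho$ and negative expectation on some entangled state; a negative value is read as certifying entanglement. $\mathcal W_{\Psi^-}=\frac12\mathbb 1\otimes\mathbb 1-|\Psi^-\rangle\langle\Psi^-|$, with $|\Psi^-\rangle=\frac1{\sqrt2}(|01\rangle-|10\rangle)$ the singlet, is such a witness. *)

theory Defs
  imports "HOL-Analysis.Analysis"
begin

text \<open>
  A system with basis indexed by \<open>'n\<close> has state vectors in \<open>complex^'n\<close> and operators in
  \<open>complex^'n^'n\<close>; a composite system is indexed by the product type \<open>'n \<times> 'm\<close>, so a pair of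
  qubits lives in \<open>complex^(2 \<times> 2)\<close>.  Index \<open>1 :: 2\<close> belongs to the basis vector $|0\rangle$
  and index \<open>2 :: 2\<close> to $|1\rangle$.
\<close>

text \<open>The library's inner product on \<open>complex^'n\<close> is only the real part of this one.\<close>

definition cinner :: "complex^'n \<Rightarrow> complex^'n \<Rightarrow> complex" where
  "cinner u v = (\<Sum>i\<in>UNIV. cnj (u $ i) * v $ i)"

definition expectation :: "complex^'n^'n \<Rightarrow> complex^'n \<Rightarrow> complex" where
  "expectation A v = cinner v (A *v v)"

definition projector :: "complex^'n \<Rightarrow> complex^'n^'n" where
  "projector v = (\<chi> i j. v $ i * cnj (v $ j))"

definition tensor_vec :: "complex^'n \<Rightarrow> complex^'m \<Rightarrow> complex^('n \<times> 'm)"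
  (infixr \<open>\<otimes>\<^sub>v\<close> 75) where
  "u \<otimes>\<^sub>v v = (\<chi> i. u $ fst i * v $ snd i)"

definition tensor_op :: "complex^'n^'n \<Rightarrow> complex^'m^'m \<Rightarrow> complex^('n \<times> 'm)^('n \<times> 'm)"
  (infixr \<open>\<otimes>\<^sub>o\<close> 75) where
  "A \<otimes>\<^sub>o B = (\<chi> i j. A $ fst i $ fst j * B $ snd i $ snd j)"

definition hermitian :: "complex^'n^'n \<Rightarrow> bool" where
  "hermitian A \<longleftrightarrow> (\<forall>i j. A $ i $ j = cnj (A $ j $ i))"

definition density_op :: "complex^'n^'n \<Rightarrow> bool" where
  "density_op \<rho> \<longleftrightarrow> (\<forall>v. expectation \<rho> v \<in> \<real>\<^sub>\<ge>\<^sub>0) \<and> trace \<rho> = 1"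

definition separable :: "complex^('n::finite \<times> 'm::finite)^('n \<times> 'm) \<Rightarrow> bool" where
  "separable \<rho> \<longleftrightarrow> \<rho> \<in> convex hull {A \<otimes>\<^sub>o B | A B. density_op A \<and> density_op B}"

text \<open>For Hermitian \<open>W\<close> and a state \<open>\<rho>\<close> the trace of \<open>W ** \<rho>\<close> is real, so taking \<open>Re\<close> loses
  nothing.\<close>

definition entanglement_witness :: "complex^('n::finite \<times> 'm::finite)^('n \<times> 'm) \<Rightarrow> bool" where
  "entanglement_witness W \<longleftrightarrow>
     hermitian W \<and>
     (\<forall>\<rho>. separable \<rho> \<longrightarrow> Re (trace (W ** \<rho>)) \<ge> 0) \<and>
     (\<exists>\<rho>. density_op \<rho> \<and> \<not> separable \<rho> \<and> Re (trace (W ** \<rho>)) < 0)"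

definition ket0 :: "complex^2" where "ket0 = vector [1, 0]"
definition ket1 :: "complex^2" where "ket1 = vector [0, 1]"

definition sigma_x :: "complex^2^2" where
  "sigma_x = vector [vector [0, 1], vector [1, 0]]"
definition sigma_y :: "complex^2^2" where
  "sigma_y = vector [vector [0, - \<i>], vector [\<i>, 0]]"
definition sigma_z :: "complex^2^2" where
  "sigma_z = vector [vector [1, 0], vector [0, - 1]]"

definition dot_sigma :: "real^3 \<Rightarrow> complex^2^2" where
  "dot_sigma n = n $ 1 *\<^sub>R sigma_x + n $ 2 *\<^sub>R sigma_y + n $ 3 *\<^sub>R sigma_z"

definition W_singlet :: "complex^(2 \<times> 2)^(2 \<times> 2)" where
  "W_singlet = (1/4) *\<^sub>R (mat 1 \<otimes>\<^sub>o mat 1)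
     + (1/4) *\<^sub>R (sigma_x \<otimes>\<^sub>o sigma_x + sigma_y \<otimes>\<^sub>o sigma_y + sigma_z \<otimes>\<^sub>o sigma_z)"

definition singlet :: "complex^(2 \<times> 2)" where
  "singlet = (1 / sqrt 2) *\<^sub>R (ket0 \<otimes>\<^sub>v ket1 - ket1 \<otimes>\<^sub>v ket0)"

definition arcsec :: "real \<Rightarrow> real" where
  "arcsec x = arccos (1 / x)"

definition chi :: real where
  "chi = arcsec (sqrt 3) / 2"

definition psi :: "complex^(2 \<times> 2)" where
  "psi = (cos chi)\<^sup>2 *\<^sub>R
     ((ket0 + (exp (\<i> * of_real pi / 4) * of_real (tan chi)) *s ket1)
      \<otimes>\<^sub>v (of_real (tan chi) *s ket0 + exp (- 3 * \<i> * of_real pi / 4) *s ket1))"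

definition n1 :: "real \<Rightarrow> real^3" where
  "n1 \<epsilon> = vector [cos \<epsilon>, sin \<epsilon> / sqrt 2, sin \<epsilon> / sqrt 2]"
definition n2 :: "real \<Rightarrow> real^3" where
  "n2 \<epsilon> = vector [sin \<epsilon> / sqrt 2, cos \<epsilon>, sin \<epsilon> / sqrt 2]"
definition n3 :: "real \<Rightarrow> real^3" where
  "n3 \<epsilon> = vector [sin \<epsilon> / sqrt 2, sin \<epsilon> / sqrt 2, cos \<epsilon>]"

definition W_misaligned :: "real \<Rightarrow> complex^(2 \<times> 2)^(2 \<times> 2)" where
  "W_misaligned \<epsilon> = (1/4) *\<^sub>R (mat 1 \<otimes>\<^sub>o mat 1)
     + (1/4) *\<^sub>R (dot_sigma (n1 \<epsilon>) \<otimes>\<^sub>o dot_sigma (n1 \<epsilon>)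
                 + dot_sigma (n2 \<epsilon>) \<otimes>\<^sub>o dot_sigma (n2 \<epsilon>)
                 + dot_sigma (n3 \<epsilon>) \<otimes>\<^sub>o dot_sigma (n3 \<epsilon>))"

lemma sigma_z_eigenvectors: "sigma_z *v ket0 = ket0" "sigma_z *v ket1 = - ket1"
  by (simp_all add: sigma_z_def ket0_def ket1_def vec_eq_iff forall_2 sum_2
      matrix_vector_mult_def)

lemma W_singlet_eq: "W_singlet = (1/2) *\<^sub>R (mat 1 \<otimes>\<^sub>o mat 1) - projector singlet"
proof -
  have s: "complex_of_real (sqrt 2) * complex_of_real (sqrt 2) = 2"
    by (simp flip: of_real_mult)
  show ?thesis
    by (simp add: W_singlet_def singlet_def projector_def tensor_op_def tensor_vec_def
        sigma_x_def sigma_y_def sigma_z_def ket0_def ket1_def vec_eq_iff forall_2 mat_def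
        scaleR_conv_of_real[where 'a=complex] field_simps s)
qed

lemma W_misaligned_0: "W_misaligned 0 = W_singlet"
  by (simp add: W_misaligned_def W_singlet_def dot_sigma_def n1_def n2_def n3_def)

end

theory Submission
  imports Defs
begin

text \<open>
  In Bloch vectors, \<open>trace ((n \<cdot> \<sigma>) A) = n \<bullet> bloch A\<close>, so the value of the misaligned operator on
  a product \<open>A \<otimes> B\<close> is \<open>(1 + (\<Sum>k. (n\<^sub>k \<bullet> bloch A) (n\<^sub>k \<bullet> bloch B))) / 4\<close>.  For orthonormal \<open>n\<^sub>k\<close> the
  sum is \<open>bloch A \<bullet> bloch B \<ge> -1\<close>, because Bloch vectors of states lie in the unit ball.
  The state \<open>psi\<close> has the antipodal Bloch vectors \<open>\<plusminus>(1,1,1)/\<surd>3\<close>, towards which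
  all three \<open>n\<^sub>k\<close> are tilted, so that the sum drops below \<open>-1\<close>.
\<close>

section \<open>Tensor products, traces and projectors\<close>

lemma sum_UNIV_prod:
  "(\<Sum>i\<in>(UNIV :: ('n::finite \<times> 'm::finite) set). f i) = (\<Sum>a\<in>UNIV. \<Sum>b\<in>UNIV. f (a, b))"
  by (simp add: UNIV_Times_UNIV[symmetric] sum.cartesian_product del: UNIV_Times_UNIV)

lemma tensor_op_mult: "(A \<otimes>\<^sub>o B) ** (C \<otimes>\<^sub>o D) = (A ** C) \<otimes>\<^sub>o (B ** D)"
  by (simp add: vec_eq_iff tensor_op_def matrix_matrix_mult_def sum_UNIV_prod sum_product ac_simps)

lemma trace_tensor_op: "trace (A \<otimes>\<^sub>o B) = trace A * trace B"
  by (simp add: trace_def tensor_op_def sum_UNIV_prod sum_product)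

lemma matrix_add_rdistrib:
  fixes A :: "'a::semiring_1^'m^'n"
  shows "(A + B) ** C = A ** C + B ** C"
  by (simp add: vec_eq_iff matrix_matrix_mult_def sum.distrib distrib_right)

lemma trace_scaleR: "trace (c *\<^sub>R (A :: complex^'n^'n)) = c *\<^sub>R trace A"
  by (simp add: trace_def scaleR_sum_right)

lemma projector_tensor_vec: "projector (u \<otimes>\<^sub>v v) = projector u \<otimes>\<^sub>o projector v"
  by (simp add: vec_eq_iff projector_def tensor_vec_def tensor_op_def)

lemma trace_projector: "trace (projector v) = cinner v v"
  by (simp add: trace_def projector_def cinner_def mult.commute)

lemma trace_mult_projector: "trace (A ** projector v) = expectation A v"
  by (simp add: trace_def projector_def cinner_def expectation_def matrix_matrix_mult_def
      matrix_vector_mult_def sum_distrib_left sum_distrib_right ac_simps)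

lemma expectation_projector: "expectation (projector v) u = of_real ((cmod (cinner v u))\<^sup>2)"
proof -
  have "expectation (projector v) u = cnj (cinner v u) * cinner v u"
    by (simp add: projector_def cinner_def expectation_def matrix_vector_mult_def
        sum_distrib_left sum_distrib_right ac_simps)
  then show ?thesis
    by (simp only: complex_norm_square mult.commute)
qed

lemma density_op_projector:
  assumes "cinner v v = 1"
  shows "density_op (projector v)"
  using assms by (simp add: density_op_def trace_projector expectation_projector)

lemma separable_projector_tensor_vec:
  assumes "cinner u u = 1" and "cinner v v = 1"
  shows "separable (projector (u \<otimes>\<^sub>v v))"
  unfolding separable_def projector_tensor_vec
  using assms by (intro hull_inc) (auto intro: density_op_projector)

section \<open>Bloch vectors of qubit operators\<close>

definition bloch :: "complex^2^2 \<Rightarrow> real^3" where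
  "bloch A = vector [2 * Re (A $ 1 $ 2), - 2 * Im (A $ 1 $ 2), Re (A $ 1 $ 1 - A $ 2 $ 2)]"

lemma trace_dot_sigma:
  assumes "hermitian A"
  shows "trace (dot_sigma n ** A) = of_real (n \<bullet> bloch A)"
proof -
  have "A $ 2 $ 1 = cnj (A $ 1 $ 2)" "Im (A $ 1 $ 1) = 0" "Im (A $ 2 $ 2) = 0"
    using assms unfolding hermitian_def by (metis Reals_cnj_iff complex_is_Real_iff)+
  then show ?thesis
    by (simp add: trace_def matrix_matrix_mult_def dot_sigma_def sigma_x_def sigma_y_def
        sigma_z_def bloch_def inner_vec_def sum_2 sum_3 complex_eq_iff algebra_simps)
qed

lemma hermitian_projector: "hermitian (projector v)"
  by (simp add: hermitian_def projector_def)

lemma trace_W_misaligned_tensor_op: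
  assumes "hermitian A" "hermitian B" "trace A = 1" "trace B = 1"
  shows "trace (W_misaligned \<epsilon> ** (A \<otimes>\<^sub>o B)) = of_real ((1 + (\<Sum>n\<leftarrow>[n1 \<epsilon>, n2 \<epsilon>, n3 \<epsilon>].
    (n \<bullet> bloch A) * (n \<bullet> bloch B))) / 4)"
  using assms
  by (simp add: W_misaligned_def matrix_add_rdistrib scalar_matrix_assoc[symmetric] trace_add
      trace_scaleR tensor_op_mult trace_tensor_op trace_dot_sigma
      scaleR_conv_of_real[where 'a=complex]
      add_divide_distrib)

lemma cinner_2: "cinner u (v :: complex^2) = cnj (u $ 1) * v $ 1 + cnj (u $ 2) * v $ 2"
  by (simp add: cinner_def sum_2)

text \<open>Realness of the quadratic form \<open>E\<close> forces \<open>A\<close> to be Hermitian,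
  by polarization. With trace 1, the squared norm of the Bloch vector is 1 - 4 det A, so the bound
  amounts to a nonnegative determinant.\<close>

lemma density_op_2:
  fixes A :: "complex^2^2"
  assumes "density_op A"
  shows "hermitian A" and "norm (bloch A) \<le> 1"
proof -
  define E where
    "E a b = cnj a * (A$1$1 * a + A$1$2 * b) + cnj b * (A$2$1 * a + A$2$2 * b)" for a b
  have E: "Im (E a b) = 0" "Re (E a b) \<ge> 0" for a b
  proof -
    have "expectation A (vector [a, b]) = E a b"
      by (simp add: E_def expectation_def cinner_2 matrix_vector_mult_def sum_2)
    then show "Im (E a b) = 0" "Re (E a b) \<ge> 0"
      using assms unfolding density_op_def by (metis complex_nonneg_Reals_iff)+
  qed
  define p q x y where "p = Re (A$1$1)" "q = Re (A$2$2)" "x = Re (A$1$2)" "y = Im (A$1$2)"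
  have im: "Im (A$1$1) = 0" "Im (A$2$2) = 0"
    using E(1)[of 1 0] E(1)[of 0 1] by (simp_all add: E_def)
  \<comment> \<open>The vector (1, 1) makes the imaginary parts of the off-diagonal entries
    opposite; (1, i) makes their real parts equal.\<close>
  have off: "A$2$1 = cnj (A$1$2)"
    using E(1)[of 1 1] E(1)[of 1 \<i>] im by (simp add: E_def complex_eq_iff)
  show "hermitian A"
    using im off by (simp add: hermitian_def forall_2 complex_eq_iff)
  have pq: "p + q = 1"
    using assms by (simp add: density_op_def trace_def sum_2 p_q_x_y_def complex_eq_iff)
  text \<open>Test vectors proportional to the columns of the adjugate matrix.\<close>
  have "p * (p * q - x\<^sup>2 - y\<^sup>2) \<ge> 0"
    using E(2)[of "Complex x y" "- of_real p"] im off
    by (simp add: E_def p_q_x_y_def power2_eq_square algebra_simps)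
  moreover have "q * (p * q - x\<^sup>2 - y\<^sup>2) \<ge> 0"
    using E(2)[of "- of_real q" "Complex x (- y)"] im off
    by (simp add: E_def p_q_x_y_def power2_eq_square algebra_simps)
  \<comment> \<open>Either of \<open>p\<close> and \<open>q\<close> may vanish, so neither
    inequality can be divided by its factor; as \<open>p + q = 1\<close>, their sum is the
    determinant itself.\<close>
  ultimately have "(p + q) * (p * q - x\<^sup>2 - y\<^sup>2) \<ge> 0"
    by (simp add: distrib_right)
  then have det: "x\<^sup>2 + y\<^sup>2 \<le> p * q"
    using pq by simp
  have "(norm (bloch A))\<^sup>2 = 4 * (x\<^sup>2 + y\<^sup>2) + (p - q)\<^sup>2"
    unfolding power2_norm_eq_inner
    by (simp add: inner_vec_def sum_3 bloch_def p_q_x_y_def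
        power_mult_distrib flip: power2_eq_square)
  also have "\<dots> \<le> (p + q)\<^sup>2"
    using det by (simp add: power2_eq_square algebra_simps)
  finally show "norm (bloch A) \<le> 1"
    using pq by (simp add: power_le_one_iff abs_square_le_1)
qed

section \<open>The witness property of \<open>W_singlet\<close>\<close>

lemma W_singlet_nonneg_product:
  assumes "density_op A" and "density_op B"
  shows "Re (trace (W_singlet ** (A \<otimes>\<^sub>o B))) \<ge> 0"
proof -
  have "\<bar>bloch A \<bullet> bloch B\<bar> \<le> norm (bloch A) * norm (bloch B)"
    by (rule Cauchy_Schwarz_ineq2)
  also have "\<dots> \<le> 1"
    using assms by (simp add: density_op_2 mult_le_one)
  finally have "1 + bloch A \<bullet> bloch B \<ge> 0"
    by simp
  moreover have "trace A = 1" "trace B = 1"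
    using assms by (simp_all add: density_op_def)
  \<comment> \<open>At angle 0 the directions \<open>n1\<close>, \<open>n2\<close>,
    \<open>n3\<close> are the standard basis, so the general trace formula reduces to the inner
    product of the Bloch vectors.\<close>
  ultimately show ?thesis
    using assms
    by (simp add: W_misaligned_0[symmetric] trace_W_misaligned_tensor_op density_op_2)
      (simp add: n1_def n2_def n3_def inner_vec_def sum_3)
qed

text \<open>The value is real-linear in the state, so the states with nonnegative value form a
  convex set; it contains the product states and hence their hull.\<close>

lemma W_singlet_nonneg_separable:
  assumes "separable \<rho>"
  shows "Re (trace (W_singlet ** \<rho>)) \<ge> 0"
proof -
  let ?f = "\<lambda>\<rho>. Re (trace (W_singlet ** \<rho>))"
  have "linear ?f"
    by (rule linearI)
      (simp_all add: matrix_add_ldistrib trace_add matrix_scalar_ac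
        scalar_matrix_assoc[symmetric] trace_scaleR)
  then have "convex (?f -` {0..})"
    by (intro convex_linear_vimage) (auto simp: convex_real_interval)
  then have "convex hull {A \<otimes>\<^sub>o B | A B. density_op A \<and> density_op B} \<subseteq> ?f -` {0..}"
    by (intro hull_minimal) (auto intro: W_singlet_nonneg_product)
  then show ?thesis
    using assms by (auto simp: separable_def)
qed

lemma hermitian_W_singlet: "hermitian W_singlet"
  by (simp add: hermitian_def W_singlet_def tensor_op_def sigma_x_def sigma_y_def sigma_z_def
      mat_def forall_2 scaleR_conv_of_real[where 'a=complex])

lemma cinner_singlet: "cinner singlet singlet = 1"
  by (simp add: cinner_def singlet_def tensor_vec_def ket0_def ket1_def sum_UNIV_prod sum_2
      scaleR_conv_of_real[where 'a=complex] flip: of_real_mult)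

lemma expectation_W_singlet_singlet: "expectation W_singlet singlet = - 1 / 2"
  by (simp add: W_singlet_def tensor_op_def sigma_x_def sigma_y_def sigma_z_def mat_def
      expectation_def matrix_vector_mult_def
      cinner_def singlet_def tensor_vec_def ket0_def ket1_def sum_UNIV_prod sum_2
      scaleR_conv_of_real[where 'a=complex] flip: of_real_mult)

text \<open>The singlet is the state detected: its value -1/2 also shows that it is not separable,
  since separable states have nonnegative value.\<close>

lemma entanglement_witness_W_singlet: "entanglement_witness W_singlet"
proof -
  have "Re (trace (W_singlet ** projector singlet)) < 0"
    by (simp add: trace_mult_projector expectation_W_singlet_singlet)
  moreover from this have "\<not> separable (projector singlet)"
    using W_singlet_nonneg_separable by fastforce
  ultimately show ?thesis
    unfolding entanglement_witness_def
    using hermitian_W_singlet W_singlet_nonneg_separable density_op_projector[OF cinner_singlet]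
    by blast
qed

section \<open>The product state \<open>psi\<close> and its Bloch vectors\<close>

definition psi1 :: "complex^2" where
  "psi1 = vector [of_real (cos chi), cis (pi / 4) * of_real (sin chi)]"

definition psi2 :: "complex^2" where
  "psi2 = vector [of_real (sin chi), - cis (pi / 4) * of_real (cos chi)]"

text \<open>\<open>2 * chi\<close> is the angle between (1,1,1) and the z axis, the polar angle of
  the Bloch vector of \<open>psi1\<close>.\<close>

lemma cos_2_chi: "cos (2 * chi) = 1 / sqrt 3"
proof -
  have "\<bar>1 / sqrt 3\<bar> \<le> 1"
    by (simp add: abs_div)
  then show ?thesis
    by (simp add: chi_def arcsec_def cos_arccos cos_arccos_abs)
qed

lemma sin_2_chi: "sin (2 * chi) = sqrt 2 / sqrt 3"
proof -
  have "sin (2 * chi) = sqrt (1 - (1 / sqrt 3)\<^sup>2)"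
    by (simp add: chi_def arcsec_def sin_arccos_abs)
  also have "\<dots> = sqrt 2 / sqrt 3"
    by (simp add: power_divide flip: real_sqrt_divide)
  finally show ?thesis .
qed

text \<open>These are the x and y Bloch components, up to sign, in the two shapes that arise once
  \<open>cos_45\<close> and \<open>sin_45\<close> expand the phase.\<close>

lemma sin_chi_cos_chi:
  "cos chi * (sqrt 2 * sin chi) = 1 / sqrt 3"
  "sin chi * (sqrt 2 * cos chi) = 1 / sqrt 3"
proof -
  have "sqrt 2 * (2 * sin chi * cos chi) = sqrt 2 * (sqrt 2 / sqrt 3)"
    using sin_2_chi by (simp only: sin_double)
  then show "cos chi * (sqrt 2 * sin chi) = 1 / sqrt 3" "sin chi * (sqrt 2 * cos chi) = 1 / sqrt 3"
    by (simp_all add: ac_simps)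
qed

text \<open>Each factor absorbs one \<open>cos chi\<close> of the prefactor, turning
  \<open>tan chi\<close> into \<open>sin chi\<close>; the two phases differ by the sign exp(-i pi) =
  -1.\<close>

lemma psi_eq: "psi = psi1 \<otimes>\<^sub>v psi2"
proof -
  have "cos chi \<noteq> 0"
    using sin_2_chi by (auto simp: sin_double)
  moreover have "exp (\<i> * of_real pi / 4) = cis (pi / 4)"
    by (simp add: cis_conv_exp)
  moreover have "exp (- 3 * \<i> * of_real pi / 4) = - cis (pi / 4)"
  proof -
    have "exp (- 3 * \<i> * of_real pi / 4) = cis (pi / 4 - pi)"
      by (simp add: cis_conv_exp algebra_simps)
    also have "\<dots> = - cis (pi / 4)"
      unfolding cis_divide[symmetric] by simp
    finally show ?thesis .
  qed
  ultimately show ?thesis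
    by (simp add: psi_def psi1_def psi2_def vec_eq_iff forall_2 tensor_vec_def ket0_def ket1_def
        scaleR_conv_of_real[where 'a=complex] tan_def power2_eq_square)
qed

lemma cinner_psi1: "cinner psi1 psi1 = 1" and cinner_psi2: "cinner psi2 psi2 = 1"
proof -
  have eq: "cnj (cis t) * of_real r * (cis t * of_real r) = of_real r * of_real r" for t r
    by (simp add: cis_cnj cis_mult flip: mult.assoc)
  have sc: "complex_of_real ((cos chi)\<^sup>2) + of_real ((sin chi)\<^sup>2) = 1"
    by (simp only: of_real_add[symmetric] sin_cos_squared_add2 of_real_1)
  show "cinner psi1 psi1 = 1" "cinner psi2 psi2 = 1"
    using sc by (simp_all add: cinner_2 psi1_def psi2_def eq power2_eq_square add.commute)
qed

text \<open>Polar angle \<open>2 * chi\<close> and azimuth \<open>pi / 4\<close> give three equal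
  components.\<close>

lemma bloch_psi1: "bloch (projector psi1) = (\<chi> i. 1 / sqrt 3)"
  using cos_2_chi sin_chi_cos_chi
  by (simp add: bloch_def projector_def psi1_def vec_eq_iff forall_3 cos_double
      cos_45 sin_45 power2_eq_square)

text \<open>\<open>psi2\<close> is orthogonal to \<open>psi1\<close>, hence antipodal on the Bloch
  sphere.\<close>

lemma bloch_psi2: "bloch (projector psi2) = (\<chi> i. - 1 / sqrt 3)"
  using cos_2_chi sin_chi_cos_chi
  by (simp add: bloch_def projector_def psi2_def vec_eq_iff forall_3 cos_double
      cos_45 sin_45 power2_eq_square)

section \<open>The misaligned value on \<open>psi\<close>\<close>

lemma expectation_W_misaligned_psi:
  "expectation (W_misaligned \<epsilon>) psi
     = of_real (1/8 * (cos (2 * \<epsilon>) - 2 * sqrt 2 * sin (2 * \<epsilon>) - 1))"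
proof -
  have "expectation (W_misaligned \<epsilon>) psi
      = trace (W_misaligned \<epsilon> ** (projector psi1 \<otimes>\<^sub>o projector psi2))"
    by (simp add: psi_eq projector_tensor_vec flip: trace_mult_projector)
  also have "\<dots> = of_real ((1 - (cos \<epsilon> + sqrt 2 * sin \<epsilon>)\<^sup>2) / 4)"
  proof -
    have half: "sin \<epsilon> / sqrt 2 = sqrt 2 * sin \<epsilon> / 2"
      by (simp add: field_simps)
    \<comment> \<open>All three directions have the same coordinate sum. With c = 1/sqrt 3 and c =
      -1/sqrt 3, each contributes -1/3 of the square.\<close>
    have "n \<bullet> (\<chi> i. c) = c * (cos \<epsilon> + sqrt 2 * sin \<epsilon>)"
      if "n \<in> {n1 \<epsilon>, n2 \<epsilon>, n3 \<epsilon>}" for n and c :: real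
      using that
      by (auto simp: n1_def n2_def n3_def inner_vec_def sum_3 half algebra_simps)
    then show ?thesis
      by (simp add: trace_W_misaligned_tensor_op hermitian_projector trace_projector cinner_psi1
          cinner_psi2 bloch_psi1 bloch_psi2 power2_eq_square)
  qed
  also have "(1 - (cos \<epsilon> + sqrt 2 * sin \<epsilon>)\<^sup>2) / 4
      = 1/8 * (cos (2 * \<epsilon>) - 2 * sqrt 2 * sin (2 * \<epsilon>) - 1)"
    unfolding cos_double_sin sin_double
    by (simp add: power2_sum power_mult_distrib cos_squared_eq field_simps)
  finally show ?thesis .
qed

theorem mainTheorem4:
  "entanglement_witness W_singlet \<and>
   separable (projector psi) \<and>
   (\<forall>\<epsilon>::real. expectation (W_misaligned \<epsilon>) psi
      = complex_of_real (1/8 * (cos (2 * \<epsilon>) - 2 * sqrt 2 * sin (2 * \<epsilon>) - 1))) \<and>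
   (\<forall>\<epsilon>::real. 0 < \<epsilon> \<and> \<epsilon> < pi / 2 \<longrightarrow> Re (expectation (W_misaligned \<epsilon>) psi) < 0)"
proof (intro conjI allI impI)
  show "separable (projector psi)"
    unfolding psi_eq by (intro separable_projector_tensor_vec cinner_psi1 cinner_psi2)
  fix \<epsilon> :: real
  assume "0 < \<epsilon> \<and> \<epsilon> < pi / 2"
  \<comment> \<open>The strict sign comes from the sine term, as \<open>2 * \<epsilon>\<close> lies
    in (0, pi); the rest, \<open>cos (2 * \<epsilon>) - 1\<close>, is at most 0.\<close>
  then have "sin (2 * \<epsilon>) > 0"
    by (intro sin_gt_zero) auto
  then have "2 * sqrt 2 * sin (2 * \<epsilon>) > 0"
    by simp
  moreover have "cos (2 * \<epsilon>) \<le> 1"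
    by simp
  ultimately show "Re (expectation (W_misaligned \<epsilon>) psi) < 0"
    unfolding expectation_W_misaligned_psi Re_complex_of_real by argo
qed (rule entanglement_witness_W_singlet expectation_W_misaligned_psi)+

end
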